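(* Let $k\geq 2$ and $p$ be integers such that $r=k(k-1)/(p-k-1)$ is a positive integer. Then the graphs \[ K_{p+r}\setminus K_{k+r} + K_k + k(k-2)K_1\quad\text{and}\quad K_p^{r(p-k)} \] are cospectral. Their common characteristic polynomial equals \[ x^{r(p-k)-1}(x+1)^{p-2}(x-k+1)\bigl(x^2-x(p-k-1)-(k+r)(p-k)\bigr). \]
   Context: Graphs are finite, simple and undirected. The characteristic polynomial of a graph with adjacency matrix $A$ is $\det(xI-A)$; two graphs are cospectral if their adjacency matrices have the same spectrum (eigenvalues with multiplicities). For integers $p\geq 3$ and $q\geq 1$, the pineapple graph $K_p^q$ is the graph on $p+q$ vertices obtained from the complete graph $K_p$ by appending $q$ pendant edges to one vertex of $K_p$ (i.e. adding $q$ new vertices, each adjacent only to one fixed vertex of $K_p$, the same one for all new vertices). For $m<n$, $K_n\setminus K_m$ denotes the graph on $n$ vertices obtained from the complete graph $K_n$ by deleting the edges of a complete subgraph $K_m$ (all vertices are kept); equivalently, it is the complete multipartite graph $K_{m,1,\ldots,1}$ on $n$ vertices. $G+H$ denotes the disjoint union of graphs $G$ and $H$, and $mK_1$ denotes $m$ isolated vertices (nothing is added if $m=0$). *)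

theory Defs
  imports
    "Graph_Theory.Pair_Digraph"
    "Graph_Theory.Kuratowski"
    "Jordan_Normal_Form.Spectral_Radius"
begin

text \<open>
  A finite simple undirected graph is a \<open>pair_graph\<close> of the library: each edge $\{u,v\}$ is the
  pair of arcs $(u,v)$, $(v,u)$.
\<close>

definition adjacency_matrix_wrt :: "'v list \<Rightarrow> 'v pair_pre_digraph \<Rightarrow> complex mat" where
  "adjacency_matrix_wrt vs G =
     mat (length vs) (length vs) (\<lambda>(i, j). if (vs ! i, vs ! j) \<in> parcs G then 1 else 0)"

text \<open>
  The enumeration of the vertices is arbitrary; \<open>char_poly_adjacency_matrix\<close> below shows that the
  characteristic polynomial does not depend on it.
\<close>

definition adjacency_matrix :: "'v pair_pre_digraph \<Rightarrow> complex mat" where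
  "adjacency_matrix G =
     adjacency_matrix_wrt (SOME vs. distinct vs \<and> set vs = pverts G) G"

definition graph_char_poly :: "'v pair_pre_digraph \<Rightarrow> complex poly" where
  "graph_char_poly G = char_poly (adjacency_matrix G)"

definition cospectral :: "'v pair_pre_digraph \<Rightarrow> 'w pair_pre_digraph \<Rightarrow> bool" where
  "cospectral G H \<longleftrightarrow>
     spectrum (adjacency_matrix G) = spectrum (adjacency_matrix H) \<and>
     (\<forall>a \<in> spectrum (adjacency_matrix G).
        order a (char_poly (adjacency_matrix G)) = order a (char_poly (adjacency_matrix H)))"

definition complete_graph :: "nat \<Rightarrow> nat pair_pre_digraph" where
  "complete_graph n =
     \<lparr> pverts = {0..<n}, parcs = {(u, v). u \<in> {0..<n} \<and> v \<in> {0..<n} \<and> u \<noteq> v} \<rparr>"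

definition empty_graph :: "nat \<Rightarrow> nat pair_pre_digraph" where
  "empty_graph n = \<lparr> pverts = {0..<n}, parcs = {} \<rparr>"

text \<open>$K_n \setminus K_m$, intended for $m < n$; the deleted clique is the one on $0, \dots, m-1$.\<close>

definition complete_minus_clique :: "nat \<Rightarrow> nat \<Rightarrow> nat pair_pre_digraph" where
  "complete_minus_clique n m =
     \<lparr> pverts = pverts (complete_graph n),
       parcs = parcs (complete_graph n) - parcs (complete_graph m) \<rparr>"

text \<open>$K_p^q$: the pendant vertices $p, \dots, p+q-1$ are attached to the vertex $0$ of $K_p$.\<close>

definition pineapple :: "nat \<Rightarrow> nat \<Rightarrow> nat pair_pre_digraph" where
  "pineapple p q =
     \<lparr> pverts = {0..<p + q},
       parcs = parcs (complete_graph p) \<union> {0} \<times> {p..<p + q} \<union> {p..<p + q} \<times> {0} \<rparr>"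

definition disjoint_union ::
    "'v pair_pre_digraph \<Rightarrow> 'w pair_pre_digraph \<Rightarrow> ('v + 'w) pair_pre_digraph" where
  "disjoint_union G H =
     \<lparr> pverts = pverts G <+> pverts H,
       parcs = map_prod Inl Inl ` parcs G \<union> map_prod Inr Inr ` parcs H \<rparr>"

lemma pair_graphI:
  assumes "finite (pverts G)" "parcs G \<subseteq> pverts G \<times> pverts G" "sym (parcs G)" "irrefl (parcs G)"
  shows "pair_graph G"
proof -
  have "finite (parcs G)"
    using assms(1,2) finite_subset by blast
  then show ?thesis
    using assms
    by unfold_locales (auto simp: symmetric_def irrefl_def)
qed

lemma complete_digraph_complete_graph: "complete_digraph n (with_proj (complete_graph n))"
proof -
  have "pair_graph (complete_graph n)"
    by (rule pair_graphI) (auto simp: complete_graph_def sym_def irrefl_def)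
  then interpret pair_graph "complete_graph n" .
  have "graph (with_proj (complete_graph n))" by unfold_locales
  then show ?thesis
    by (auto simp: complete_digraph_def complete_graph_def)
qed

lemma pair_graph_empty_graph: "pair_graph (empty_graph n)"
  by (rule pair_graphI) (auto simp: empty_graph_def sym_def irrefl_def)

lemma pair_graph_complete_minus_clique: "pair_graph (complete_minus_clique n m)"
  by (rule pair_graphI)
    (auto simp: complete_minus_clique_def complete_graph_def sym_def irrefl_def)

lemma pair_graph_pineapple: "p \<ge> 1 \<Longrightarrow> pair_graph (pineapple p q)"
  by (rule pair_graphI) (auto simp: pineapple_def complete_graph_def sym_def irrefl_def)

lemma pair_graph_disjoint_union:
  assumes "pair_graph G" "pair_graph H"
  shows "pair_graph (disjoint_union G H)"
proof -
  interpret G: pair_graph G by fact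
  interpret H: pair_graph H by fact
  have "sym (parcs G)" "sym (parcs H)"
    using G.pair_sym_arcs H.pair_sym_arcs by (auto simp: symmetric_def)
  moreover have loops: "(v, v) \<notin> parcs G" "(w, w) \<notin> parcs H" for v w
    using G.pair_no_loops[of "(v, v)"] H.pair_no_loops[of "(w, w)"] by auto
  ultimately show ?thesis
    using G.pair_finite_verts G.pair_finite_verts H.pair_finite_verts
    by (intro pair_graphI)
      (auto simp: disjoint_union_def sym_def irrefl_def loops
        dest: G.in_arcsD1 G.in_arcsD2 H.in_arcsD1 H.in_arcsD2)
qed

lemma char_poly_adjacency_matrix_wrt_cong:
  assumes "distinct vs" "distinct ws" "set vs = set ws"
  shows "char_poly (adjacency_matrix_wrt vs G) = char_poly (adjacency_matrix_wrt ws G)"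
proof -
  have "mset ws = mset vs"
    using assms by (simp add: set_eq_iff_mset_eq_distinct)
  then obtain p where p: "p permutes {..<length vs}" and ws: "permute_list p vs = ws"
    by (rule mset_eq_permutation)
  define n where "n = length vs"
  define C where "C = char_poly_matrix (adjacency_matrix_wrt vs G)"
  define B where "B = mat n n (\<lambda>(i, j). C $$ (p i, j))"
  have p': "p permutes {0..<n}" using p by (simp add: n_def lessThan_atLeast0)
  have len: "length ws = n" using ws by (auto simp: n_def)
  have pn: "p i < n \<longleftrightarrow> i < n" for i
    using permutes_in_image[OF p', of i] by simp
  have pinj: "p i = p j \<longleftrightarrow> i = j" for i j
    using permutes_inj[OF p'] by (auto dest: injD)
  have nth: "ws ! i = vs ! p i" if "i < n" for i
    using that ws p by (auto simp: permute_list_nth n_def)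
  have C: "C \<in> carrier_mat n n" and B: "B \<in> carrier_mat n n"
    by (auto simp: C_def B_def n_def adjacency_matrix_wrt_def char_poly_matrix_def)
  have "mat n n (\<lambda>(i, j). B $$ (i, p j)) =
      transpose_mat (mat n n (\<lambda>(i, j). transpose_mat B $$ (p i, j)))"
    using B by (intro eq_matI) (auto simp: pn)
  then have cols: "det (mat n n (\<lambda>(i, j). B $$ (i, p j))) = signof p * det B"
    using det_permute_rows[OF _ p', of "transpose_mat B"] B
      det_transpose[of "mat n n (\<lambda>(i, j). transpose_mat B $$ (p i, j))" n]
      det_transpose[OF B]
    by simp
  have "char_poly_matrix (adjacency_matrix_wrt ws G) = mat n n (\<lambda>(i, j). B $$ (i, p j))"
    by (rule eq_matI)
      (auto simp: B_def C_def char_poly_matrix_def adjacency_matrix_wrt_def len nth pn pinj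
        simp flip: n_def)
  then have "char_poly (adjacency_matrix_wrt ws G) = signof p * (signof p * det C)"
    using cols det_permute_rows[OF C p'] by (simp add: char_poly_def B_def)
  also have "\<dots> = char_poly (adjacency_matrix_wrt vs G)"
    by (simp add: char_poly_def C_def sign_def)
  finally show ?thesis by simp
qed

lemma char_poly_adjacency_matrix:
  assumes "distinct vs" "set vs = pverts G"
  shows "char_poly (adjacency_matrix G) = char_poly (adjacency_matrix_wrt vs G)"
proof -
  let ?P = "\<lambda>vs. distinct vs \<and> set vs = pverts G"
  have "?P (SOME vs. ?P vs)"
    by (rule someI[of ?P vs]) (use assms in simp)
  then show ?thesis
    using assms unfolding adjacency_matrix_def
    by (intro char_poly_adjacency_matrix_wrt_cong) auto
qed

end

theory Submission
  imports Defs
begin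

text \<open>
  The vertices of \<open>K\<^sub>n \<setminus> K\<^sub>m\<close> and of the pineapple graph fall into two, respectively three,
  classes of twins. With \<open>U\<close> the class indicator matrix and \<open>B\<close> the symmetric matrix of
  adjacencies between classes, \<open>xI - A = D - U B U\<^sup>T\<close> with \<open>D\<close> diagonal, so Sylvester's identity
  \<open>det (1 - M N) = det (1 - N M)\<close> reduces the determinant to one of size 2 or 3. Here \<open>D\<close> has
  diagonal entries \<open>x\<close> and \<open>x + 1\<close>, so this is done for \<open>x \<notin> {0, -1}\<close>, which determines the
  polynomials. The two products finally agree because of \<open>r (p - k - 1) = k (k - 1)\<close>.
\<close>

section \<open>Determinants: Sylvester's identity and reduction to class size\<close>

text \<open>Both \<open>M * L\<close> and \<open>L * M\<close> are block upper triangular with an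
  identity as one diagonal block, and the two products have the same determinant.\<close>

lemma det_one_minus_mult_comm:
  fixes A C :: "'a :: idom mat"
  assumes A: "A \<in> carrier_mat n m" and C: "C \<in> carrier_mat m n"
  shows "det (1\<^sub>m n - A * C) = det (1\<^sub>m m - C * A)"
proof -
  define M where "M = four_block_mat (1\<^sub>m n) A C (1\<^sub>m m)"
  define L where "L = four_block_mat (1\<^sub>m n) (0\<^sub>m n m) (- C) (1\<^sub>m m)"
  have M: "M \<in> carrier_mat (n + m) (n + m)" and L: "L \<in> carrier_mat (n + m) (n + m)"
    using A C by (auto simp: M_def L_def)
  have AC: "A * C \<in> carrier_mat n n" and CA: "C * A \<in> carrier_mat m m"
    using A C by auto
  have "M * L = four_block_mat (1\<^sub>m n - A * C) A (0\<^sub>m m n) (1\<^sub>m m)"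
    unfolding M_def L_def
    by (subst mult_four_block_mat[of _ n n _ m _ m])
      (use A C AC in \<open>auto intro!: cong_four_block_mat simp: add_uminus_minus_mat\<close>)
  then have det_mult_ML: "det (M * L) = det (1\<^sub>m n - A * C)"
    using det_four_block_mat_lower_left_zero[OF minus_carrier_mat[OF AC] A refl one_carrier_mat]
    by simp
  have "L * M = four_block_mat (1\<^sub>m n) A (0\<^sub>m m n) (1\<^sub>m m - C * A)"
    unfolding M_def L_def
    by (subst mult_four_block_mat[of _ n n _ m _ m])
      (use A C CA in \<open>auto intro!: cong_four_block_mat simp: add_uminus_minus_mat\<close>)
  then have "det (L * M) = det (1\<^sub>m m - C * A)"
    using det_four_block_mat_lower_left_zero[OF one_carrier_mat A refl minus_carrier_mat[OF CA]]
    by simp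
  then show ?thesis
    using det_mult_ML M L by (simp add: det_mult mult.commute)
qed

text \<open>The matrix on the left is \<open>D * (1 - U * V)\<close>: the division by
  \<open>d (c i)\<close> inside \<open>U\<close> pulls out the diagonal, whence
  \<open>d a \<noteq> 0\<close>. Since \<open>V\<close> is the class indicator, \<open>V * U\<close>
  sums over a class, which produces the class sizes, and Sylvester's identity replaces
  \<open>U * V\<close> by \<open>V * U\<close>.\<close>

lemma det_diag_minus_block_constant:
  fixes d :: "nat \<Rightarrow> 'a :: field"
  assumes c: "\<And>i. i < n \<Longrightarrow> c i < m" and d: "\<And>a. a < m \<Longrightarrow> d a \<noteq> 0"
  shows "det (mat n n (\<lambda>(i, j). (if i = j then d (c i) else 0) - B (c i) (c j))) =
    (\<Prod>i<n. d (c i)) *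
    det (mat m m (\<lambda>(a, b). (if a = b then 1 else 0) - of_nat (card {i. i < n \<and> c i = a}) / d a * B a b))"
proof -
  define U where "U = mat n m (\<lambda>(i, b). B (c i) b / d (c i))"
  define V where "V = mat m n (\<lambda>(a, j). if c j = a then 1 else 0 :: 'a)"
  define D where "D = mat n n (\<lambda>(i, j). if i = j then d (c i) else 0)"
  have U: "U \<in> carrier_mat n m" and V: "V \<in> carrier_mat m n" and D: "D \<in> carrier_mat n n"
    by (auto simp: U_def V_def D_def)
  have UV: "(U * V) $$ (i, j) = B (c i) (c j) / d (c i)" if "i < n" "j < n" for i j
    using that c[of j]
    by (simp add: U_def V_def scalar_prod_def if_distrib[of "\<lambda>z. _ * z"] cong: if_cong)
  have VU: "(V * U) $$ (a, b) = of_nat (card {i. i < n \<and> c i = a}) / d a * B a b"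
    if "a < m" "b < m" for a b
  proof -
    have "(V * U) $$ (a, b) = (\<Sum>i\<in>{0..<n}. if c i = a then B a b / d a else 0)"
      using that by (auto simp: U_def V_def scalar_prod_def intro!: sum.cong)
    also have "\<dots> = of_nat (card ({0..<n} \<inter> {i. c i = a})) * (B a b / d a)"
      by (simp add: sum.If_cases)
    also have "{0..<n} \<inter> {i. c i = a} = {i. i < n \<and> c i = a}"
      by auto
    finally show ?thesis by simp
  qed
  define W where "W = 1\<^sub>m n - U * V"
  have W: "W \<in> carrier_mat n n"
    unfolding W_def by (intro minus_carrier_mat mult_carrier_mat[OF U V])
  have "mat n n (\<lambda>(i, j). (if i = j then d (c i) else 0) - B (c i) (c j)) = D * W"
    (is "?M = _")
  proof (rule eq_matI)
    fix i j assume "i < dim_row (D * W)" "j < dim_col (D * W)"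
    then have ij: "i < n" "j < n" using D W by auto
    have "(D * W) $$ (i, j) = d (c i) * W $$ (i, j)"
      using ij W
      by (simp add: D_def scalar_prod_def if_distrib[of "\<lambda>z. z * _"] cong: if_cong)
    also have "\<dots> = (if i = j then d (c i) else 0) - B (c i) (c j)"
      using ij U V UV[OF ij] d[OF c[OF ij(1)]]
      by (simp add: W_def field_simps del: index_mult_mat(1))
    finally show "?M $$ (i, j) = (D * W) $$ (i, j)"
      using ij by simp
  qed (use D W in auto)
  moreover have "det D = (\<Prod>i<n. d (c i))"
    by (subst det_upper_triangular[OF _ D])
      (auto simp: D_def diag_mat_def prod.list_conv_set_nth lessThan_atLeast0)
  moreover have "1\<^sub>m m - V * U =
      mat m m (\<lambda>(a, b). (if a = b then 1 else 0) - of_nat (card {i. i < n \<and> c i = a}) / d a * B a b)"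
    using U V by (intro eq_matI) (auto simp: VU simp del: index_mult_mat(1))
  moreover have "det (D * W) = det D * det (1\<^sub>m m - V * U)"
    by (simp only: det_mult[OF D W]) (simp only: W_def det_one_minus_mult_comm[OF U V])
  ultimately show ?thesis by simp
qed

lemma det_mat_2:
  "det (mat 2 2 f) = f (0, 0) * f (1, 1) - f (0, 1) * f (1, 0 :: nat)"
  for f :: "nat \<times> nat \<Rightarrow> 'a :: comm_ring_1"
  by (subst laplace_expansion_column[of _ 2 0])
    (auto simp: numeral_2_eq_2 cofactor_def mat_delete_def det_single)

lemma det_mat_3:
  "det (mat 3 3 f) = 
     f (0, 0) * (f (1, 1) * f (2, 2) - f (1, 2) * f (2, 1)) 
   - f (1, 0) * (f (0, 1) * f (2, 2) - f (0, 2) * f (2, 1))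
   + f (2, 0) * (f (0, 1) * f (1, 2) - f (0, 2) * f (1, 1 :: nat))"
  for f :: "nat \<times> nat \<Rightarrow> 'a :: comm_ring_1"
proof -
  have *: "{..<3} = {0, 1, 2 :: nat}" by auto
  show ?thesis
    by (subst laplace_expansion_column[of _ 3 0])
      (auto simp: * cofactor_def mat_delete_def det_mat_2[unfolded numeral_2_eq_2] algebra_simps
        numeral_2_eq_2 numeral_3_eq_3)
qed

section \<open>Characteristic polynomials of the individual graphs, from their values\<close>

text \<open>Multiplication by \<open>x * (x + 1)\<close> makes both sides vanish at the excluded
  points, so the products agree everywhere and the nonzero factor cancels.\<close>

lemma poly_eqI_punctured:
  fixes P Q :: "complex poly"
  assumes "\<And>x. x \<noteq> 0 \<Longrightarrow> x \<noteq> - 1 \<Longrightarrow> poly P x = poly Q x"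
  shows "P = Q"
proof -
  have "poly ([:0, 1:] * [:1, 1:] * P) x = poly ([:0, 1:] * [:1, 1:] * Q) x" for x
    using assms[of x] by (cases "x = 0 \<or> x = - 1") auto
  then have "[:0, 1:] * [:1, 1:] * P = [:0, 1:] * [:1, 1:] * Q"
    by (simp add: poly_eq_poly_eq_iff[symmetric] fun_eq_iff del: mult_pCons_left)
  then show ?thesis
    by (simp only: mult_cancel_left) simp
qed

lemma poly_graph_char_poly:
  assumes "pverts G = {0..<n}"
  shows "poly (graph_char_poly G) x =
    det (mat n n (\<lambda>(i, j). (if i = j then x else 0) - (if (i, j) \<in> parcs G then 1 else 0)))"
proof -
  have "graph_char_poly G = char_poly (adjacency_matrix_wrt [0..<n] G)"
    unfolding graph_char_poly_def using assms by (intro char_poly_adjacency_matrix) auto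
  then show ?thesis
    unfolding char_poly_def
    by (auto intro!: poly_det_cong[of _ n] simp: char_poly_matrix_def adjacency_matrix_wrt_def)
qed

text \<open>
  The factors \<open>x\<close> and \<open>x + 1\<close> on the left avoid the exponents \<open>m - 1\<close> and \<open>n - m - 1\<close>, which
  would be truncated for \<open>m = 0\<close> (the complete graph) and \<open>m = n\<close> (the empty graph).
\<close>

lemma graph_char_poly_complete_minus_clique:
  assumes "m \<le> n"
  shows "[:0, 1:] * [:1, 1:] * graph_char_poly (complete_minus_clique n m) =
    [:0, 1:] ^ m * [:1, 1:] ^ (n - m) *
    [:- of_nat (m * (n - m)), 1 - of_nat (n - m), 1:]"
proof (rule poly_eqI_punctured)
  fix x :: complex
  assume x: "x \<noteq> 0" "x \<noteq> - 1"
  then have x1: "x + 1 \<noteq> 0" "1 + x \<noteq> 0" by (simp_all add: eq_neg_iff_add_eq_0 add.commute)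
  \<comment> \<open>Class 0 is the independent set left by the deleted clique, class 1 the remaining
    vertices. Class 1 is a clique, so \<open>B 1 1 = 1\<close> also subtracts 1 on the diagonal;
    \<open>d 1 = x + 1\<close> compensates for this.\<close>
  define c where "c = (\<lambda>i. if i < m then 0 else 1 :: nat)"
  define d where "d = (\<lambda>a. if a = (0 :: nat) then x else x + 1)"
  define B where "B = (\<lambda>(a :: nat) (b :: nat). if a = 0 \<and> b = 0 then 0 else 1 :: complex)"
  have card: "card {i. i < n \<and> c i = 0} = m" "card {i. i < n \<and> c i = Suc 0} = n - m"
  proof -
    have "{i. i < n \<and> c i = 0} = {..<m}" "{i. i < n \<and> c i = Suc 0} = {m..<n}"
      using assms by (auto simp: c_def)
    then show "card {i. i < n \<and> c i = 0} = m" "card {i. i < n \<and> c i = Suc 0} = n - m"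
      by auto
  qed
  have "poly (graph_char_poly (complete_minus_clique n m)) x =
      det (mat n n (\<lambda>(i, j). (if i = j then d (c i) else 0) - B (c i) (c j)))"
    by (subst poly_graph_char_poly[where n = n])
      (auto simp: complete_minus_clique_def complete_graph_def c_def d_def B_def
        intro!: arg_cong[where f = det])
  also have "\<dots> = (\<Prod>i<n. d (c i)) * det (mat 2 2 (\<lambda>(a, b).
      (if a = b then 1 else 0) - of_nat (card {i. i < n \<and> c i = a}) / d a * B a b))"
    using x x1 by (intro det_diag_minus_block_constant) (auto simp: c_def d_def)
  also have "(\<Prod>i<n. d (c i)) = x ^ m * (x + 1) ^ (n - m)"
  proof -
    have "{..<n} = {..<m} \<union> {m..<n}" using assms by auto
    moreover have "{..<m} \<inter> {m..<n} = {}" by auto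
    ultimately show ?thesis
      by (simp add: prod.union_disjoint c_def d_def)
  qed
  also have "det (mat 2 2 (\<lambda>(a, b).
      (if a = b then 1 else 0) - of_nat (card {i. i < n \<and> c i = a}) / d a * B a b)) =
      1 - of_nat (n - m) / (x + 1) - of_nat m / x * (of_nat (n - m) / (x + 1))"
    by (simp add: det_mat_2 card d_def B_def)
  finally have poly_value: "poly (graph_char_poly (complete_minus_clique n m)) x =
      x ^ m * (x + 1) ^ (n - m) *
      (1 - of_nat (n - m) / (x + 1) - of_nat m / x * (of_nat (n - m) / (x + 1)))" .
  \<comment> \<open>Here \<open>u\<close> and \<open>v\<close> stand for \<open>N / (x + 1)\<close>
    and \<open>M / x\<close>, so that clearing denominators becomes a polynomial identity.\<close>
  have *: "x * (1 + x) * (a * (1 - u - v * u)) = a * (x * (x + (1 - N)) - M * N)"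
    if "u * (x + 1) = N" "v * x = M" for a u v M N
    unfolding that[symmetric] by (simp add: algebra_simps)
  have "x * (1 + x) * (a * (1 - N / (x + 1) - M / x * (N / (x + 1)))) =
      a * (x * (x + (1 - N)) - M * N)" for a M N
    by (rule *) (use x1 x in simp_all)
  then have "x * (1 + x) * poly (graph_char_poly (complete_minus_clique n m)) x =
      x ^ m * (x + 1) ^ (n - m) * (x * (x + (1 - of_nat (n - m))) - of_nat m * of_nat (n - m))"
    unfolding poly_value .
  then show "poly ([:0, 1:] * [:1, 1:] * graph_char_poly (complete_minus_clique n m)) x =
    poly ([:0, 1:] ^ m * [:1, 1:] ^ (n - m) *
      [:- of_nat (m * (n - m)), 1 - of_nat (n - m), 1:]) x"
    unfolding of_nat_mult by (simp add: algebra_simps del: of_nat_diff)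
qed

lemma graph_char_poly_complete_graph:
  assumes "n \<ge> 1"
  shows "graph_char_poly (complete_graph n) = [:1, 1:] ^ (n - 1) * [:1 - of_nat n, 1:]"
proof -
  \<comment> \<open>This is the case \<open>m = 0\<close>: the constant coefficient of the quadratic
    vanishes, which supplies the factor \<open>x\<close> to be cancelled.\<close>
  have "[:0, 1:] * [:1, 1:] * graph_char_poly (complete_graph n) =
      [:1, 1:] ^ n * [:0, 1 - of_nat n, 1:]"
    using graph_char_poly_complete_minus_clique[of 0 n]
    by (simp add: complete_minus_clique_def complete_graph_def)
  also have "[:1, 1 :: complex:] ^ n = [:1, 1:] * [:1, 1:] ^ (n - 1)"
    using power_minus_mult[of n "[:1, 1 :: complex:]"] assms by (simp only: mult.commute)
  also have "[:0, 1 - of_nat n, 1 :: complex:] = [:0, 1:] * [:1 - of_nat n, 1:]"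
    by simp
  also have "[:1, 1:] * [:1, 1:] ^ (n - 1) * ([:0, 1:] * [:1 - of_nat n, 1:]) =
      [:0, 1:] * [:1, 1:] * ([:1, 1 :: complex:] ^ (n - 1) * [:1 - of_nat n, 1:])"
    by (simp only: mult_ac)
  finally show ?thesis
    by (simp only: mult_cancel_left) simp
qed

lemma graph_char_poly_empty_graph: "graph_char_poly (empty_graph n) = [:0, 1:] ^ n"
proof -
  have "complete_minus_clique n n = empty_graph n"
    by (simp add: complete_minus_clique_def empty_graph_def complete_graph_def)
  \<comment> \<open>At \<open>m = n\<close> the quadratic is \<open>x * (x + 1)\<close>, exactly the
    extra factor on the left.\<close>
  then have "[:0, 1:] * [:1, 1:] * graph_char_poly (empty_graph n) = [:0, 1:] * [:1, 1:] * [:0, 1:] ^ n"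
    using graph_char_poly_complete_minus_clique[of n n] by (simp add: mult.commute)
  then show ?thesis
    by (simp only: mult_cancel_left) simp
qed

text \<open>The cubic is the characteristic polynomial of the quotient matrix of the three twin
  classes; all remaining eigenvalues are 0 or -1.\<close>

lemma graph_char_poly_pineapple:
  assumes "p \<ge> 2" "q \<ge> 1"
  shows "graph_char_poly (pineapple p q) = [:0, 1:] ^ (q - 1) * [:1, 1:] ^ (p - 2) *
    [:of_nat (q * (p - 2)), - of_nat (p - 1 + q), - of_nat (p - 2), 1:]"
proof (rule poly_eqI_punctured)
  fix x :: complex
  assume x: "x \<noteq> 0" "x \<noteq> - 1"
  then have x1: "x + 1 \<noteq> 0" "1 + x \<noteq> 0" by (simp_all add: eq_neg_iff_add_eq_0 add.commute)
  \<comment> \<open>Class 0 is the vertex carrying the pendant edges, class 1 the other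
    \<open>p - 1\<close> clique vertices, class 2 the pendant vertices. Only class 1 is given
    internal adjacency, hence \<open>x + 1\<close> there alone.\<close>
  define c where "c = (\<lambda>i. if i = 0 then 0 else if i < p then 1 else 2 :: nat)"
  define d where "d = (\<lambda>a. if a = (1 :: nat) then x + 1 else x)"
  define B where
    "B = (\<lambda>(a :: nat) (b :: nat).
      if (a, b) \<in> {(0, 1), (1, 0), (0, 2), (2, 0), (1, 1)} then 1 else 0 :: complex)"
  obtain p' q' where pq: "p = Suc (Suc p')" "q = Suc q'"
    using assms by (metis One_nat_def Suc_le_D Suc_1 Suc_le_mono)
  have card: "card {i. i < p + q \<and> c i = 0} = 1" "card {i. i < p + q \<and> c i = Suc 0} = p - 1"
    "card {i. i < p + q \<and> c i = 2} = q"
  proof -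
    have "{i. i < p + q \<and> c i = 0} = {0}" "{i. i < p + q \<and> c i = Suc 0} = {1..<p}"
      "{i. i < p + q \<and> c i = 2} = {p..<p + q}"
      using assms by (auto simp: c_def split: if_splits)
    then show "card {i. i < p + q \<and> c i = 0} = 1" "card {i. i < p + q \<and> c i = Suc 0} = p - 1"
      "card {i. i < p + q \<and> c i = 2} = q"
      by auto
  qed
  have "poly (graph_char_poly (pineapple p q)) x =
      det (mat (p + q) (p + q) (\<lambda>(i, j). (if i = j then d (c i) else 0) - B (c i) (c j)))"
  proof -
    have "(if i = j then x else 0) - (if (i, j) \<in> parcs (pineapple p q) then 1 else 0) =
        (if i = j then d (c i) else 0) - B (c i) (c j)" if "i < p + q" "j < p + q" for i j
      using that assms
      by (cases "i = 0"; cases "j = 0"; cases "i < p"; cases "j < p")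
        (simp_all add: pineapple_def complete_graph_def c_def d_def B_def)
    then show ?thesis
      by (subst poly_graph_char_poly[where n = "p + q"])
        (auto simp: pineapple_def intro!: arg_cong[where f = det])
  qed
  also have "\<dots> = (\<Prod>i<p + q. d (c i)) * det (mat 3 3 (\<lambda>(a, b).
      (if a = b then 1 else 0) - of_nat (card {i. i < p + q \<and> c i = a}) / d a * B a b))"
    using x x1 by (intro det_diag_minus_block_constant) (auto simp: c_def d_def)
  also have "(\<Prod>i<p + q. d (c i)) = x ^ Suc q * (x + 1) ^ (p - 1)"
  proof -
    have "{..<p + q} = insert 0 ({1..<p} \<union> {p..<p + q})" using assms by auto
    moreover have "{1..<p} \<inter> {p..<p + q} = {}" by auto
    ultimately show ?thesis
      using assms by (simp add: prod.union_disjoint c_def d_def)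
  qed
  also have "det (mat 3 3 (\<lambda>(a, b).
      (if a = b then 1 else 0) - of_nat (card {i. i < p + q \<and> c i = a}) / d a * B a b)) =
      1 - of_nat (p - 1) / (x + 1) - of_nat (p - 1) / (x + 1) * (1 / x)
        - of_nat q / x * (1 / x * (1 - of_nat (p - 1) / (x + 1)))"
    by (simp add: det_mat_3 card d_def B_def del: of_nat_diff)
  \<comment> \<open>The factor \<open>x * x * (x + 1)\<close> is split off from the product of the
    diagonal to clear the denominators of the 3 by 3 determinant.\<close>
  also have "x ^ Suc q * (x + 1) ^ (p - 1) * \<dots> =
      x ^ (q - 1) * (x + 1) ^ (p - 2) * (x * x * (x + 1) * \<dots>)"
    unfolding mult.assoc[symmetric] by (simp add: pq del: of_nat_Suc)
  also have "x * x * (x + 1) * (1 - of_nat (p - 1) / (x + 1) - of_nat (p - 1) / (x + 1) * (1 / x)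
        - of_nat q / x * (1 / x * (1 - of_nat (p - 1) / (x + 1)))) =
      of_nat q * (of_nat (p - 1) - 1) +
      x * (- (of_nat (p - 1) + of_nat q) + x * (- (of_nat (p - 1) - 1) + x))"
  proof -
    \<comment> \<open>\<open>u\<close>, \<open>v\<close>, \<open>w\<close> stand for the three
      fractions, with \<open>w\<close> for \<open>1 / x\<close>. The inner identity regroups them so
      that each occurs only multiplied by its denominator.\<close>
    have *: "x * x * (x + 1) * (1 - u - u * w - v * (w * (1 - u))) =
        M * (N - 1) + x * (- (N + M) + x * (- (N - 1) + x))"
      if "u * (x + 1) = N" "v * x = M" "w * x = 1" for u v w M N
    proof -
      have *: "x * x * (x + 1) * (1 - u - u * w - v * (w * (1 - u))) =
          x * x * (x + 1) - x * x * (u * (x + 1)) - x * (u * (x + 1)) * (w * x)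
            - v * x * (w * x) * (x + 1 - u * (x + 1))"
        by (simp add: algebra_simps)
      then show ?thesis
        unfolding that by (simp add: algebra_simps)
    qed
    show ?thesis
      by (rule *) (use x1 x in simp_all)
  qed
  finally show "poly (graph_char_poly (pineapple p q)) x =
    poly ([:0, 1:] ^ (q - 1) * [:1, 1:] ^ (p - 2) *
      [:of_nat (q * (p - 2)), - of_nat (p - 1 + q), - of_nat (p - 2), 1:]) x"
    by (simp add: pq algebra_simps)
qed

section \<open>Disjoint unions and cospectrality\<close>

text \<open>Listing the vertices of \<open>G\<close> before those of \<open>H\<close> makes the
  matrix block diagonal; the choice of enumeration does not affect the characteristic
  polynomial.\<close>

lemma graph_char_poly_disjoint_union:
  assumes "finite (pverts G)" "finite (pverts H)"
  shows "graph_char_poly (disjoint_union G H) = graph_char_poly G * graph_char_poly H"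
proof -
  obtain us vs where us: "distinct us" "set us = pverts G" and vs: "distinct vs" "set vs = pverts H"
    using assms finite_distinct_list by metis
  let ?l = "length us" and ?m = "length vs"
  define A where "A = adjacency_matrix_wrt us G"
  define B where "B = adjacency_matrix_wrt vs H"
  have A: "char_poly_matrix A \<in> carrier_mat ?l ?l" and B: "char_poly_matrix B \<in> carrier_mat ?m ?m"
    by (auto simp: A_def B_def adjacency_matrix_wrt_def)
  have "graph_char_poly (disjoint_union G H) =
      char_poly (adjacency_matrix_wrt (map Inl us @ map Inr vs) (disjoint_union G H))"
    unfolding graph_char_poly_def using us vs
    by (intro char_poly_adjacency_matrix) (auto simp: distinct_map disjoint_union_def)
  also have "char_poly_matrix (adjacency_matrix_wrt (map Inl us @ map Inr vs) (disjoint_union G H)) =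
      four_block_mat (char_poly_matrix A) (0\<^sub>m ?l ?m) (0\<^sub>m ?m ?l) (char_poly_matrix B)"
    (is "?L = ?R")
  proof (rule eq_matI)
    have arcs: "(Inl a, Inl b) \<in> parcs (disjoint_union G H) \<longleftrightarrow> (a, b) \<in> parcs G"
      "(Inr c, Inr d) \<in> parcs (disjoint_union G H) \<longleftrightarrow> (c, d) \<in> parcs H"
      "(Inl a, Inr d) \<notin> parcs (disjoint_union G H)"
      "(Inr c, Inl b) \<notin> parcs (disjoint_union G H)" for a b c d
      by (auto simp: disjoint_union_def)
    fix i j assume "i < dim_row ?R" "j < dim_col ?R"
    then have "i < ?l + ?m" "j < ?l + ?m"
      using A B by simp_all
    then show "?L $$ (i, j) = ?R $$ (i, j)"
      by (cases "i < ?l"; cases "j < ?l")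
        (simp_all add: char_poly_matrix_def A_def B_def adjacency_matrix_wrt_def nth_append arcs
          eq_diff_iff)
  qed (simp_all add: char_poly_matrix_def A_def B_def adjacency_matrix_wrt_def)
  then have "char_poly (adjacency_matrix_wrt (map Inl us @ map Inr vs) (disjoint_union G H)) =
      char_poly A * char_poly B"
    using A B by (simp add: char_poly_def det_four_block_mat_lower_left_zero[of _ ?l _ ?m])
  also have "\<dots> = graph_char_poly G * graph_char_poly H"
    unfolding graph_char_poly_def A_def B_def
    using us vs by (simp add: char_poly_adjacency_matrix)
  finally show ?thesis .
qed

lemma spectrum_adjacency_matrix:
  "spectrum (adjacency_matrix G) = {a. poly (graph_char_poly G) a = 0}"
proof -
  have "adjacency_matrix G \<in> carrier_mat (dim_row (adjacency_matrix G)) (dim_row (adjacency_matrix G))"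
    by (auto simp: adjacency_matrix_def adjacency_matrix_wrt_def)
  from spectrum_root_char_poly[OF this] show ?thesis
    by (simp add: graph_char_poly_def)
qed

text \<open>The spectrum is the root set of the characteristic polynomial and multiplicities are
  root orders, so both are determined by it.\<close>

lemma cospectralI: "graph_char_poly G = graph_char_poly H \<Longrightarrow> cospectral G H"
  by (simp add: cospectral_def spectrum_adjacency_matrix) (simp add: graph_char_poly_def)

section \<open>Comparison of the two products\<close>

theorem proposition2p2:
  fixes k p r :: int
  assumes "k \<ge> 2"
    and "real_of_int r = real_of_int (k * (k - 1)) / real_of_int (p - k - 1)"
    and "r > 0"
  shows
    "let G = disjoint_union
               (disjoint_union
                 (complete_minus_clique (nat (p + r)) (nat (k + r)))
                 (complete_graph (nat k)))
               (empty_graph (nat (k * (k - 2))));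
         H = pineapple (nat p) (nat (r * (p - k)));
         P = [:0, 1:] ^ nat (r * (p - k) - 1) * [:1, 1:] ^ nat (p - 2) * [:1 - of_int k, 1:]
               * [:- of_int ((k + r) * (p - k)), - of_int (p - k - 1), 1:]
     in cospectral G H \<and> graph_char_poly G = P \<and> graph_char_poly H = P"
proof -
  \<comment> \<open>A zero denominator would give the quotient the value 0, contradicting
    \<open>r > 0\<close>.\<close>
  have "real_of_int (p - k - 1) \<noteq> 0"
  proof
    assume "real_of_int (p - k - 1) = 0"
    then show False
      using assms(2,3) by (simp only: div_by_0)
  qed
  then have "real_of_int r * real_of_int (p - k - 1) = real_of_int (k * (k - 1))"
    using assms(2) by (rule nonzero_eq_divide_eq[THEN iffD1])
  then have "real_of_int (r * (p - k - 1)) = real_of_int (k * (k - 1))"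
    unfolding of_int_mult[of r] .
  then have rk: "r * (p - k - 1) = k * (k - 1)"
    by (simp only: of_int_eq_iff)
  moreover have "k * (k - 1) > 0"
    using assms(1) by simp
  ultimately have pk: "p - k - 1 > 0"
    using assms(3) by (metis zero_less_mult_pos)
  \<comment> \<open>These shifts turn every \<open>nat\<close> argument and exponent into an
    expression in natural numbers without subtraction. The hypothesis on \<open>r\<close> becomes
    \<open>(u + 1) * t = (s + 2) * (s + 1)\<close>.\<close>
  define s t u where "s = nat (k - 2)" and "t = nat (p - k - 1)" and "u = nat (r - 1)"
  have k: "k = int s + 2" and p: "p = int s + int t + 3" and r: "r = int u + 1" and t: "t \<ge> 1"
    using assms pk by (auto simp: s_def t_def u_def)
  have "int ((u + 1) * t) = int ((s + 2) * (s + 1))"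
    using rk by (simp add: k p r algebra_simps)
  then have ut: "(u + 1) * t = (s + 2) * (s + 1)"
    by (simp only: of_nat_eq_iff)
  then have utc: "(of_nat u + 1) * of_nat t = (of_nat s + 2) * (of_nat s + 1 :: complex)"
    by (metis of_nat_1 of_nat_add of_nat_mult of_nat_numeral)
  have nats: "nat (p + r) = s + t + u + 4" "nat (k + r) = s + u + 3" "nat k = s + 2"
    "nat (k * (k - 2)) = (s + 2) * s" "nat p = s + t + 3" "nat (r * (p - k)) = (u + 1) * (t + 1)"
    "nat (r * (p - k) - 1) = (u + 1) * t + u" "nat (p - 2) = s + t + 1"
    by (simp_all add: k p r nat_eq_iff algebra_simps)
  \<comment> \<open>\<open>R\<close> is the quotient quadratic of the component with the deleted
    clique, where \<open>m = k + r\<close> and \<open>n - m = p - k\<close>.\<close>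
  define X Y R :: "complex poly"
    where "X = [:0, 1:]" and "Y = [:1, 1:]"
      and "R = [:- of_int ((k + r) * (p - k)), - of_int (p - k - 1), 1:]"
  note XY_folds = X_def[symmetric] Y_def[symmetric]
  have "X \<noteq> 0" "Y \<noteq> 0"
    by (simp_all add: X_def Y_def)
  define P where "P = X ^ nat (r * (p - k) - 1) * Y ^ nat (p - 2) * [:1 - of_int k, 1:] * R"
  have "X * Y * graph_char_poly (complete_minus_clique (s + t + u + 4) (s + u + 3)) =
      X ^ (s + u + 3) * Y ^ (t + 1) * R"
  proof -
    have "[:- of_nat ((s + u + 3) * (t + 1)), 1 - of_nat (t + 1), 1:] = R"
      by (simp add: R_def k p r algebra_simps)
    moreover have "s + t + u + 4 - (s + u + 3) = t + 1" "s + u + 3 \<le> s + t + u + 4"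
      by simp_all
    ultimately show ?thesis
      using graph_char_poly_complete_minus_clique[of "s + u + 3" "s + t + u + 4"]
      by (simp only: XY_folds)
  qed
  also have "\<dots> = X * Y * (X ^ (s + u + 2) * Y ^ t * R)"
    by (simp add: eval_nat_numeral)
  finally have "graph_char_poly (complete_minus_clique (s + t + u + 4) (s + u + 3)) =
      X ^ (s + u + 2) * Y ^ t * R"
    using \<open>X \<noteq> 0\<close> \<open>Y \<noteq> 0\<close> by simp
  moreover have "graph_char_poly (complete_graph (s + 2)) = Y ^ (s + 1) * [:1 - of_int k, 1:]"
    by (subst graph_char_poly_complete_graph) (simp_all add: k Y_def)
  moreover have "graph_char_poly (empty_graph ((s + 2) * s)) = X ^ ((s + 2) * s)"
    by (simp only: graph_char_poly_empty_graph X_def)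
  \<comment> \<open>The powers of \<open>X\<close> match because of the relation \<open>ut\<close>:
    this is what fixes the number \<open>k * (k - 2)\<close> of isolated vertices.\<close>
  moreover have "(u + 1) * t + u = (s + u + 2) + (s + 2) * s"
    unfolding ut by (simp add: algebra_simps)
  ultimately have G: "graph_char_poly (disjoint_union
               (disjoint_union
                 (complete_minus_clique (nat (p + r)) (nat (k + r)))
                 (complete_graph (nat k)))
               (empty_graph (nat (k * (k - 2))))) = P"
    unfolding P_def nats
    by (subst graph_char_poly_disjoint_union; (subst graph_char_poly_disjoint_union)?)
      (simp_all add: disjoint_union_def complete_minus_clique_def complete_graph_def empty_graph_def
        power_add mult_ac del: mult_pCons_left mult_pCons_right)
  have H: "graph_char_poly (pineapple (nat p) (nat (r * (p - k)))) = P"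
  proof -
    \<comment> \<open>The cubic of the pineapple graph has the root \<open>k - 1\<close>, the
      largest eigenvalue of the component \<open>complete_graph (nat k)\<close>, and
      \<open>R\<close> is the cofactor.\<close>
    have "[:of_nat ((u + 1) * (t + 1) * (s + t + 1)), - of_nat (s + t + 2 + (u + 1) * (t + 1)),
        - of_nat (s + t + 1), 1:] = [:1 - of_int k, 1:] * R"
    proof -
      \<comment> \<open>These are the constant coefficients, the only ones whose equality depends on
        \<open>ut\<close>; the others agree identically. The product \<open>(U + 1) * T\<close> is
        isolated first so that the relation can be substituted.\<close>
      have "(U + 1) * (T + 1) * (S + T + 1) = (S + 1) * ((S + 2 + (U + 1)) * (T + 1))"
        if "(U + 1) * T = (S + 2) * (S + 1)" for S T U :: complex
      proof -
        have "(U + 1) * (T + 1) * (S + T + 1) = (T + 1) * ((U + 1) * (S + 1) + (U + 1) * T)"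
          by (simp add: algebra_simps)
        then show ?thesis
          unfolding that by (simp add: algebra_simps)
      qed
      from this[OF utc] show ?thesis
        by (simp add: R_def k p r algebra_simps)
    qed
    moreover have "s + t + 3 - 1 = s + t + 2" "s + t + 3 - 2 = s + t + 1"
      "(u + 1) * (t + 1) - 1 = (u + 1) * t + u" "s + t + 3 \<ge> 2" "(u + 1) * (t + 1) \<ge> 1"
      by simp_all
    ultimately show ?thesis
      using graph_char_poly_pineapple[of "s + t + 3" "(u + 1) * (t + 1)"]
      unfolding P_def nats by (simp only: XY_folds mult.assoc)
  qed
  show ?thesis
    using cospectralI G H unfolding P_def X_def Y_def R_def Let_def by metis
qed

end
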